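(* Suppose $G$ is an abstract snake graph with $d$ tiles, with diagonal labels $i_1,\dots,i_d$, initial edges $a,b$ and final edges $w,z$, and with signs $b_T(\mathcal L_T,i_j)\in\{1,-1\}$ for $1\le j\le d$. Let $M_d$ be the associated $2\times2$ matrix, and let $\operatorname{ur}$ denote the upper right entry of a $2\times 2$ matrix. Then the perfect matching enumerator of $G$ is given as follows, where the sums are over all perfect matchings $P$ of $G$. If $b_T(\mathcal L_T,i_d)=1$, then $$\sum_P x(P)\,y_{\mathcal L_T}(P)=x_{i_1}\cdots x_{i_d}\,\operatorname{ur}\left(\begin{bmatrix}\frac{x_w}{x_{i_d}}&x_zy_{i_d}\\-\frac1{x_z}&0\end{bmatrix}M_d\begin{bmatrix}0&x_a\\-\frac1{x_a}&\frac{x_b}{x_{i_1}}\end{bmatrix}\right).$$ If $b_T(\mathcal L_T,i_d)=-1$, then $$\sum_P x(P)\,y_{\mathcal L_T}(P)=x_{i_1}\cdots x_{i_d}\,\operatorname{ur}\left(\begin{bmatrix}\frac{x_wy_{i_d}}{x_{i_d}}&x_z\\-\frac{y_{i_d}}{x_z}&0\end{bmatrix}M_d\begin{bmatrix}0&x_a\\-\frac1{x_a}&\frac{x_b}{x_{i_1}}\end{bmatrix}\right).$$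
   Context: **Abstract snake graph with $d$ tiles.** Unit square tiles $G_1,\dots,G_d$ in the plane; for $1\le j\le d-1$ the tile $G_{j+1}$ is glued either directly above $G_j$ (then the parallelogram $H_j$, formed by the upper-right half of $G_j$ and the lower-left half of $G_{j+1}$, is called north-pointing) or directly to the right of $G_j$ ($H_j$ is called east-pointing). The diagonal of $G_j$ from its NW to its SE corner carries the label $i_j$; diagonals are not edges of the graph. Edge labels: if $H_j$ is north-pointing, the common edge of $G_j,G_{j+1}$ is labelled $a_j$, the East edge of $G_j$ is labelled $i_{j+1}$ and the West edge of $G_{j+1}$ is labelled $i_j$. If $H_j$ is east-pointing, the common edge is labelled $a_j$, the North edge of $G_j$ is labelled $i_{j+1}$ and the South edge of $G_{j+1}$ is labelled $i_j$. The South edge of $G_1$ is labelled $a$ and the West edge of $G_1$ is labelled $b$. If $d$ is odd, the North edge of $G_d$ is labelled $w$ and its East edge $z$; if $d$ is even, the East edge of $G_d$ is labelled $w$ and its North edge $z$. **Weights.** $x_e$ ($e$ a label) and $y_{i_j}$ are commuting indeterminates; $x(P)$ is the product of $x_e$ over the labels $e$ of the edges in $P$. The signs $b_T(\mathcal L_T,i_j)$ are the Shear coordinates, with respect to a triangulation $T$, of the principal lamination $\mathcal L_T$ at the arcs labelling the diagonals. A perfect matching $P$ orients every diagonal: there is a unique path from the SW corner of $G_1$ to the NE corner of $G_d$ that alternates between edges of $P$ and the diagonals; the diagonal of $G_j$ is oriented up if traversed from SE to NW and down if traversed from NW to SE. The diagonal of $G_j$ is $\mathcal L_T$-oriented if: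 $j$ is odd and either $b_T(\mathcal L_T,i_j)=1$ and it is oriented down, or $b_T(\mathcal L_T,i_j)=-1$ and it is oriented up; or $j$ is even and either $b_T(\mathcal L_T,i_j)=1$ and it is oriented up, or $b_T(\mathcal L_T,i_j)=-1$ and it is oriented down. Put $y_{\mathcal L_T}(P)=\prod y_{i_j}$ over all $j$ whose diagonal is $\mathcal L_T$-oriented. **Matrices.** $M_1=I_2$ and $M_d=m_{d-1}\cdots m_1$ for $d>1$. The matrix $m_1$ is of first type if $H_1$ is north-pointing, and otherwise of second type; for $j>1$, $m_j$ is of first type if $H_{j-1}$ and $H_j$ have the same shape, and otherwise of second type. If $b_T(\mathcal L_T,i_j)=1$, then $$m_j=\begin{bmatrix}1&0\\ \frac{x_{a_j}}{x_{i_j}x_{i_{j+1}}}&y_{i_j}\end{bmatrix}\ (\text{first type}),\qquad m_j=\begin{bmatrix}\frac{x_{i_{j+1}}}{x_{i_j}}&x_{a_j}y_{i_j}\\0&\frac{x_{i_j}y_{i_j}}{x_{i_{j+1}}}\end{bmatrix}\ (\text{second type}).$$ If $b_T(\mathcal L_T,i_j)=-1$, then $$m_j=\begin{bmatrix}y_{i_j}&0\\ \frac{x_{a_j}y_{i_j}}{x_{i_j}x_{i_{j+1}}}&1\end{bmatrix}\ (\text{first type}),\qquad m_j=\begin{bmatrix}\frac{x_{i_{j+1}}y_{i_j}}{x_{i_j}}&x_{a_j}\\0&\frac{x_{i_j}}{x_{i_{j+1}}}\end{bmatrix}\ (\text{second type}).$$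
   Formalization: The type rule for m_j, j>1, is corrected: m_j has the type of m_{j-1} if H_{j-1}, H_j have different shapes, and the other type if the same shape. The rule as stated fails for three tiles in a column (it gives 4 instead of 5 matchings). *)

theory Defs
  imports
    "HOL-Analysis.Analysis"
    "HOL-Computational_Algebra.Fraction_Field"
    "HOL-Library.Poly_Mapping"
begin

section \<open>Abstract snake graphs\<close>

datatype shape = North | East

text \<open>
  Tiles are numbered \<open>1, \<dots>, ntiles\<close>. \<open>shape G j\<close> and \<open>glue G j\<close> (the label $a_j$) are meaningful
  for \<open>1 \<le> j < ntiles G\<close>, \<open>diag G j\<close> (the label $i_j$) for \<open>1 \<le> j \<le> ntiles G\<close>; other values are
  never used. Labels are allowed to coincide.
\<close>

record 'l snake_graph =
  ntiles :: nat
  shape :: "nat \<Rightarrow> shape"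
  diag :: "nat \<Rightarrow> 'l"
  glue :: "nat \<Rightarrow> 'l"
  label_a :: 'l
  label_b :: 'l
  label_w :: 'l
  label_z :: 'l

type_synonym point = "nat \<times> nat"

text \<open>
  The graph is drawn in the integer grid with the SW corner of tile 1 at the origin. Since each tile
  lies above or to the right of the preceding one, tiles meet in a common edge only where they
  are glued.
\<close>

fun SW :: "'l snake_graph \<Rightarrow> nat \<Rightarrow> point" where
  "SW G 0 = (0, 0)"
| "SW G (Suc 0) = (0, 0)"
| "SW G (Suc (Suc j)) =
    (let (p, q) = SW G (Suc j) in
     case shape G (Suc j) of North \<Rightarrow> (p, q + 1) | East \<Rightarrow> (p + 1, q))"

definition SE :: "'l snake_graph \<Rightarrow> nat \<Rightarrow> point" where
  "SE G j = (fst (SW G j) + 1, snd (SW G j))"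

definition NW :: "'l snake_graph \<Rightarrow> nat \<Rightarrow> point" where
  "NW G j = (fst (SW G j), snd (SW G j) + 1)"

definition NE :: "'l snake_graph \<Rightarrow> nat \<Rightarrow> point" where
  "NE G j = (fst (SW G j) + 1, snd (SW G j) + 1)"

definition south :: "'l snake_graph \<Rightarrow> nat \<Rightarrow> point set" where
  "south G j = {SW G j, SE G j}"

definition west :: "'l snake_graph \<Rightarrow> nat \<Rightarrow> point set" where
  "west G j = {SW G j, NW G j}"

definition north :: "'l snake_graph \<Rightarrow> nat \<Rightarrow> point set" where
  "north G j = {NW G j, NE G j}"

definition east :: "'l snake_graph \<Rightarrow> nat \<Rightarrow> point set" where
  "east G j = {SE G j, NE G j}"

definition diagonal :: "'l snake_graph \<Rightarrow> nat \<Rightarrow> point set" where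
  "diagonal G j = {NW G j, SE G j}"

definition vertices :: "'l snake_graph \<Rightarrow> point set" where
  "vertices G = (\<Union>j\<in>{1..ntiles G}. {SW G j, SE G j, NW G j, NE G j})"

definition edges :: "'l snake_graph \<Rightarrow> point set set" where
  "edges G = (\<Union>j\<in>{1..ntiles G}. {south G j, west G j, north G j, east G j})"

definition diagonals :: "'l snake_graph \<Rightarrow> point set set" where
  "diagonals G = diagonal G ` {1..ntiles G}"

inductive has_label :: "'l snake_graph \<Rightarrow> point set \<Rightarrow> 'l \<Rightarrow> bool" for G where
  "has_label G (south G 1) (label_a G)"
| "has_label G (west G 1) (label_b G)"
| "1 \<le> j \<Longrightarrow> j < ntiles G \<Longrightarrow> shape G j = North \<Longrightarrow> has_label G (north G j) (glue G j)"
| "1 \<le> j \<Longrightarrow> j < ntiles G \<Longrightarrow> shape G j = North \<Longrightarrow> has_label G (east G j) (diag G (j + 1))"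
| "1 \<le> j \<Longrightarrow> j < ntiles G \<Longrightarrow> shape G j = North \<Longrightarrow> has_label G (west G (j + 1)) (diag G j)"
| "1 \<le> j \<Longrightarrow> j < ntiles G \<Longrightarrow> shape G j = East \<Longrightarrow> has_label G (east G j) (glue G j)"
| "1 \<le> j \<Longrightarrow> j < ntiles G \<Longrightarrow> shape G j = East \<Longrightarrow> has_label G (north G j) (diag G (j + 1))"
| "1 \<le> j \<Longrightarrow> j < ntiles G \<Longrightarrow> shape G j = East \<Longrightarrow> has_label G (south G (j + 1)) (diag G j)"
| "odd (ntiles G) \<Longrightarrow> has_label G (north G (ntiles G)) (label_w G)"
| "odd (ntiles G) \<Longrightarrow> has_label G (east G (ntiles G)) (label_z G)"
| "even (ntiles G) \<Longrightarrow> has_label G (east G (ntiles G)) (label_w G)"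
| "even (ntiles G) \<Longrightarrow> has_label G (north G (ntiles G)) (label_z G)"

text \<open>Every edge of a snake graph with at least one tile has exactly one label.\<close>

definition edge_label :: "'l snake_graph \<Rightarrow> point set \<Rightarrow> 'l" where
  "edge_label G e = (THE l. has_label G e l)"


section \<open>Perfect matchings and orientation of diagonals\<close>

definition perfect_matching :: "'l snake_graph \<Rightarrow> point set set \<Rightarrow> bool" where
  "perfect_matching G P \<longleftrightarrow> P \<subseteq> edges G \<and> (\<forall>v\<in>vertices G. \<exists>!e. e \<in> P \<and> v \<in> e)"

text \<open>
  A path is given by its list of vertices. Its first step lies in \<open>P\<close>: the SW corner of tile 1 is
  not on any diagonal.
\<close>

definition alternating_path :: "'l snake_graph \<Rightarrow> point set set \<Rightarrow> point list \<Rightarrow> bool" where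
  "alternating_path G P vs \<longleftrightarrow>
     vs \<noteq> [] \<and> distinct vs \<and> hd vs = SW G 1 \<and> last vs = NE G (ntiles G) \<and>
     (\<forall>k. Suc k < length vs \<longrightarrow>
        {vs ! k, vs ! Suc k} \<in> (if even k then P else diagonals G))"

definition matching_path :: "'l snake_graph \<Rightarrow> point set set \<Rightarrow> point list" where
  "matching_path G P = (THE vs. alternating_path G P vs)"

definition traverses :: "point list \<Rightarrow> point \<Rightarrow> point \<Rightarrow> bool" where
  "traverses vs u v \<longleftrightarrow> (\<exists>k. Suc k < length vs \<and> vs ! k = u \<and> vs ! Suc k = v)"

definition oriented_up :: "'l snake_graph \<Rightarrow> point set set \<Rightarrow> nat \<Rightarrow> bool" where
  "oriented_up G P j \<longleftrightarrow> traverses (matching_path G P) (SE G j) (NW G j)"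

definition oriented_down :: "'l snake_graph \<Rightarrow> point set set \<Rightarrow> nat \<Rightarrow> bool" where
  "oriented_down G P j \<longleftrightarrow> traverses (matching_path G P) (NW G j) (SE G j)"

text \<open>\<open>b l\<close> stands for the sign $b_T(\mathcal{L}_T, l)$ at the arc \<open>l\<close>.\<close>

definition lam_oriented ::
    "'l snake_graph \<Rightarrow> ('l \<Rightarrow> int) \<Rightarrow> point set set \<Rightarrow> nat \<Rightarrow> bool" where
  "lam_oriented G b P j \<longleftrightarrow>
     (odd j \<and> (b (diag G j) = 1 \<and> oriented_down G P j \<or> b (diag G j) = - 1 \<and> oriented_up G P j)) \<or>
     (even j \<and> (b (diag G j) = 1 \<and> oriented_up G P j \<or> b (diag G j) = - 1 \<and> oriented_down G P j))"


section \<open>Indeterminates and weights\<close>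

datatype 'l indet = X 'l | Y 'l

text \<open>
  The linear order on the indeterminates has no mathematical meaning here; it is needed because the
  library derives that polynomials have no zero divisors from an order on the exponents.
\<close>

instantiation indet :: (linorder) linorder
begin

fun less_eq_indet :: "'a indet \<Rightarrow> 'a indet \<Rightarrow> bool" where
  "less_eq_indet (X k) (X l) = (k \<le> l)"
| "less_eq_indet (X k) (Y l) = True"
| "less_eq_indet (Y k) (X l) = False"
| "less_eq_indet (Y k) (Y l) = (k \<le> l)"

definition less_indet :: "'a indet \<Rightarrow> 'a indet \<Rightarrow> bool" where
  "less_indet u v \<longleftrightarrow> u \<le> v \<and> \<not> v \<le> u"

instance
proof
  fix u v w :: "'a indet"
  show "(u < v) = (u \<le> v \<and> \<not> v \<le> u)" by (rule less_indet_def)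
  show "u \<le> u" by (cases u) auto
  show "u \<le> v \<Longrightarrow> v \<le> w \<Longrightarrow> u \<le> w" by (cases u; cases v; cases w) auto
  show "u \<le> v \<Longrightarrow> v \<le> u \<Longrightarrow> u = v" by (cases u; cases v) auto
  show "u \<le> v \<or> v \<le> u" by (cases u; cases v) auto
qed

end

text \<open>
  The field of rational functions in the indeterminates $x_l$ and $y_l$: the field of fractions of
  the integer polynomials, a polynomial being a finitely supported map from monomials
  \<open>'l indet \<Rightarrow>\<^sub>0 nat\<close> to coefficients.
\<close>

type_synonym 'l ratfun = "(('l indet \<Rightarrow>\<^sub>0 nat) \<Rightarrow>\<^sub>0 int) fract"

definition indet :: "'l::linorder indet \<Rightarrow> 'l ratfun" where
  "indet v = Fract (Poly_Mapping.single (Poly_Mapping.single v 1) 1) 1"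

definition x_var :: "'l::linorder \<Rightarrow> 'l ratfun" where
  "x_var l = indet (X l)"

definition y_var :: "'l::linorder \<Rightarrow> 'l ratfun" where
  "y_var l = indet (Y l)"

definition x_weight :: "'l::linorder snake_graph \<Rightarrow> point set set \<Rightarrow> 'l ratfun" where
  "x_weight G P = (\<Prod>e\<in>P. x_var (edge_label G e))"

definition y_weight ::
    "'l::linorder snake_graph \<Rightarrow> ('l \<Rightarrow> int) \<Rightarrow> point set set \<Rightarrow> 'l ratfun" where
  "y_weight G b P = (\<Prod>j\<in>{j\<in>{1..ntiles G}. lam_oriented G b P j}. y_var (diag G j))"


section \<open>The matrices\<close>

definition mat2 :: "'a \<Rightarrow> 'a \<Rightarrow> 'a \<Rightarrow> 'a \<Rightarrow> 'a::zero ^ 2 ^ 2" where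
  "mat2 p q r s = vector [vector [p, q], vector [r, s]]"

definition ur :: "'a ^ 2 ^ 2 \<Rightarrow> 'a" where
  "ur M = M $ 1 $ 2"

text \<open>
  The type of $m_j$ for $j > 1$ depends on the type of $m_{j-1}$: along a straight stretch of tiles
  ($H_{j-1}$ and $H_j$ of the same shape) the types alternate, and at a turn the type is kept. (Calling
  $m_j$ of first type whenever $H_{j-1}$ and $H_j$ have the same shape, irrespective of $m_{j-1}$, gives
  the wrong matrix: for three tiles in a column both $m_1$ and $m_2$ would be of first type, and with all
  indeterminates set to 1 the matrix formula would yield 4, whereas there are 5 perfect matchings.)
\<close>

fun first_type :: "'l snake_graph \<Rightarrow> nat \<Rightarrow> bool" where
  "first_type G 0 = True"
| "first_type G (Suc 0) = (shape G 1 = North)"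
| "first_type G (Suc (Suc j)) =
    (if shape G (Suc j) = shape G (Suc (Suc j))
     then \<not> first_type G (Suc j) else first_type G (Suc j))"

definition step_matrix ::
    "'l::linorder snake_graph \<Rightarrow> ('l \<Rightarrow> int) \<Rightarrow> nat \<Rightarrow> 'l ratfun ^ 2 ^ 2" where
  "step_matrix G b j =
    (let xj = x_var (diag G j); xj' = x_var (diag G (j + 1)); xa = x_var (glue G j); yj = y_var (diag G j) in
     if b (diag G j) = 1 then
       (if first_type G j
        then mat2 1                0
                  (xa / (xj * xj')) yj
        else mat2 (xj' / xj) (xa * yj)
                  0          (xj * yj / xj'))
     else
       (if first_type G j
        then mat2 yj                    0
                  (xa * yj / (xj * xj')) 1
        else mat2 (xj' * yj / xj) xa
                  0               (xj / xj')))"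

primrec step_product ::
    "'l::linorder snake_graph \<Rightarrow> ('l \<Rightarrow> int) \<Rightarrow> nat \<Rightarrow> 'l ratfun ^ 2 ^ 2" where
  "step_product G b 0 = mat 1"
| "step_product G b (Suc n) = step_matrix G b (Suc n) ** step_product G b n"

text \<open>$M_d = m_{d-1} \cdots m_1$, where $d$ is the number of tiles; $M_1$ is the identity.\<close>

definition snake_matrix ::
    "'l::linorder snake_graph \<Rightarrow> ('l \<Rightarrow> int) \<Rightarrow> 'l ratfun ^ 2 ^ 2" where
  "snake_matrix G b = step_product G b (ntiles G - 1)"

end

theory Submission
  imports Defs
begin

text \<open>
  The vertices \<open>(p, q)\<close> with \<open>p + q = j\<close>, the \<open>j\<close>-th level, are the NW and SE corners of tile \<open>j\<close>
  (with a single vertex at either end), and every edge joins consecutive levels. Hence in a perfect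
  matching exactly one vertex of each level is matched downwards and the other one upwards, so a perfect
  matching is a set \<open>D\<close> of levels, those whose NW corner is matched downwards; its alternating path enters
  level \<open>j\<close> at that vertex and crosses the diagonal, downwards iff \<open>j \<in> D\<close>. Weights and
  orientations are thus local in \<open>D\<close>, and the enumerator is a transfer matrix product. After exchanging the
  two states on every other level, and rescaling by products of the \<open>x\<close>-variables of the diagonals, the
  transfer matrices become the matrices \<open>m\<^sub>j\<close>.
\<close>

section \<open>Levels and links\<close>

text \<open>The Boolean is ignored on the two end levels, which have a single vertex; the first and
  last edges can then be treated like all others.\<close>

definition level_vertex :: "'l snake_graph \<Rightarrow> nat \<Rightarrow> bool \<Rightarrow> point" where
  "level_vertex G j c =
     (if j = 0 then SW G 1 else if ntiles G < j then NE G (ntiles G)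
      else if c then NW G j else SE G j)"

definition height :: "point \<Rightarrow> nat" where
  "height v = fst v + snd v"

lemma SW_Suc:
  "1 \<le> j \<Longrightarrow> SW G (Suc j) =
     (case shape G j of North \<Rightarrow> (fst (SW G j), snd (SW G j) + 1) | East \<Rightarrow> (fst (SW G j) + 1, snd (SW G j)))"
  by (cases j) (auto simp: Let_def split: prod.splits shape.splits)

text \<open>Either gluing moves the SW corner by one unit; the truncated \<open>j - 1\<close> also
  fits the default \<open>SW G 0 = (0, 0)\<close>.\<close>

lemma height_SW: "height (SW G j) = j - 1"
proof (induction j)
  case (Suc j)
  then show ?case
    by (cases "j = 0") (auto simp: SW_Suc height_def split: shape.splits)
qed (simp add: height_def)

lemma height_corners:
  "1 \<le> j \<Longrightarrow> height (SE G j) = j" "1 \<le> j \<Longrightarrow> height (NW G j) = j"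
  "1 \<le> j \<Longrightarrow> height (NE G j) = Suc j"
  using height_SW[of G j] by (auto simp: height_def SE_def NW_def NE_def)

lemma height_level_vertex:
  assumes "1 \<le> ntiles G" "j \<le> Suc (ntiles G)"
  shows "height (level_vertex G j c) = j"
  using assms height_SW[of G 1] by (auto simp: level_vertex_def height_corners)

lemma level_vertex_inner:
  assumes "1 \<le> j" "j \<le> ntiles G"
  shows "level_vertex G j True = NW G j" "level_vertex G j False = SE G j"
  using assms by (auto simp: level_vertex_def)

lemma level_vertex_ends:
  "level_vertex G 0 c = SW G 1" "level_vertex G (Suc (ntiles G)) c = NE G (ntiles G)"
  by (auto simp: level_vertex_def)

lemma level_vertex_eq_iff:
  assumes "1 \<le> ntiles G" "j \<le> Suc (ntiles G)" "k \<le> Suc (ntiles G)"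
  shows "level_vertex G j c = level_vertex G k c' \<longleftrightarrow>
    j = k \<and> (1 \<le> j \<and> j \<le> ntiles G \<longrightarrow> c = c')"
proof -
  have "j = k" if "level_vertex G j c = level_vertex G k c'"
    using that assms height_level_vertex by metis
  moreover have "NW G j \<noteq> SE G j"
    by (simp add: NW_def SE_def)
  ultimately show ?thesis
    by (auto simp: level_vertex_def)
qed

text \<open>Depending on the shape, \<open>SW G j\<close> is the NW or SE corner of the preceding
  tile, and \<open>NE G j\<close> the SE or NW corner of the next one.\<close>

lemma corner_level_vertex:
  assumes "1 \<le> j" "j \<le> ntiles G"
  obtains c c' where "SW G j = level_vertex G (j - 1) c" "NE G j = level_vertex G (Suc j) c'"
proof -
  have "\<exists>c. SW G j = level_vertex G (j - 1) c"
  proof (cases "j = 1")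
    case False
    then obtain i where i: "j = Suc i" "1 \<le> i"
      using assms by (cases j) auto
    then show ?thesis
      using assms SW_Suc[of i G]
      by (cases "shape G i") (auto simp: level_vertex_def NW_def SE_def intro: exI[of _ True] exI[of _ False])
  qed (simp add: level_vertex_ends)
  moreover have "\<exists>c. NE G j = level_vertex G (Suc j) c"
  proof (cases "j = ntiles G")
    case False
    then show ?thesis
      using assms SW_Suc[of j G]
      by (cases "shape G j") (auto simp: level_vertex_def NW_def SE_def NE_def intro: exI[of _ True] exI[of _ False])
  qed (simp add: level_vertex_ends)
  ultimately show thesis using that by blast
qed

lemma edge_between_levels:
  assumes "e \<in> edges G"
  obtains j c c' where "j \<le> ntiles G" "e = {level_vertex G j c, level_vertex G (Suc j) c'}"
proof -
  obtain k where k: "1 \<le> k" "k \<le> ntiles G" "e \<in> {south G k, west G k, north G k, east G k}"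
    using assms by (auto simp: edges_def)
  obtain c c' where c: "SW G k = level_vertex G (k - 1) c" "NE G k = level_vertex G (Suc k) c'"
    using corner_level_vertex k by metis
  from k have *: "Suc (k - 1) = k" "k - 1 \<le> ntiles G" by auto
  \<comment> \<open>The four instances are the west, south, north and east edges, in this
    order.\<close>
  show thesis
    using k(3) that[of "k - 1" c True] that[of "k - 1" c False] that[of k True c'] that[of k False c']
    unfolding * level_vertex_inner[OF k(1,2)] c[symmetric] south_def west_def north_def east_def
    using k(2) *(2) by auto
qed

lemma vertices_eq:
  assumes "1 \<le> ntiles G"
  shows "vertices G = {level_vertex G j c |j c. j \<le> Suc (ntiles G)}" (is "_ = ?R")
proof
  show "vertices G \<subseteq> ?R"
  proof
    fix v assume "v \<in> vertices G"
    then obtain k where k: "1 \<le> k" "k \<le> ntiles G" "v \<in> {SW G k, SE G k, NW G k, NE G k}"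
      by (auto simp: vertices_def)
    obtain c c' where c: "SW G k = level_vertex G (k - 1) c" "NE G k = level_vertex G (Suc k) c'"
      using corner_level_vertex k by metis
    from k(1,2) have *: "k - 1 \<le> Suc (ntiles G)" "k \<le> Suc (ntiles G)" "Suc k \<le> Suc (ntiles G)" by auto
    show "v \<in> ?R"
      using k(3) * unfolding level_vertex_inner[OF k(1,2), symmetric] c by blast
  qed
  show "?R \<subseteq> vertices G"
  proof
    fix v assume "v \<in> ?R"
    then obtain j c where v: "v = level_vertex G j c" by blast
    have "1 \<in> {1..ntiles G}" "ntiles G \<in> {1..ntiles G}" using assms by auto
    moreover have "j \<in> {1..ntiles G}" if "j \<noteq> 0" "\<not> ntiles G < j" using that by auto
    ultimately show "v \<in> vertices G"
      unfolding vertices_def level_vertex_def v by (auto simp del: atLeastAtMost_iff SW.simps One_nat_def)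
  qed
qed

section \<open>Edge labels and link weights, level by level\<close>

lemma sum_height_edges:
  assumes "1 \<le> j"
  shows "sum height (south G j) = 2 * j - 1" "sum height (west G j) = 2 * j - 1"
    "sum height (north G j) = 2 * j + 1" "sum height (east G j) = 2 * j + 1"
proof -
  have "SW G j \<noteq> SE G j" "SW G j \<noteq> NW G j" "NW G j \<noteq> NE G j" "SE G j \<noteq> NE G j"
    by (auto simp: NW_def SE_def NE_def prod_eq_iff)
  then show "sum height (south G j) = 2 * j - 1" "sum height (west G j) = 2 * j - 1"
    "sum height (north G j) = 2 * j + 1" "sum height (east G j) = 2 * j + 1"
    using assms by (auto simp: south_def west_def north_def east_def height_corners height_SW)
qed

text \<open>The height sum recovers the lower level \<open>j\<close> from the edge as a mere set of
  points.\<close>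

lemma sum_height_link:
  assumes "1 \<le> ntiles G" "j \<le> ntiles G"
  shows "sum height {level_vertex G j c, level_vertex G (Suc j) c'} = 2 * j + 1"
  using assms by (simp add: level_vertex_eq_iff height_level_vertex)

lemma edge_label_eqI:
  assumes "has_label G e l" "\<And>l'. has_label G e l' \<Longrightarrow> l' = l"
  shows "edge_label G e = l"
  unfolding edge_label_def using assms by (rule the_equality)

text \<open>The height sum fixes the tile in each rule of \<open>has_label\<close>; only the labels
  placed between levels \<open>j\<close> and \<open>Suc j\<close> survive, so uniqueness of a label
  becomes a finite check.\<close>

lemma has_label_levelD:
  assumes "has_label G e l" "sum height e = 2 * j + 1" "1 \<le> ntiles G"
  shows "j = 0 \<and> (e = south G 1 \<and> l = label_a G \<or> e = west G 1 \<and> l = label_b G) \<or>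
    1 \<le> j \<and> j < ntiles G \<and> shape G j = North \<and>
      (e = north G j \<and> l = glue G j \<or> e = east G j \<and> l = diag G (j + 1) \<or> e = west G (j + 1) \<and> l = diag G j) \<or>
    1 \<le> j \<and> j < ntiles G \<and> shape G j = East \<and>
      (e = east G j \<and> l = glue G j \<or> e = north G j \<and> l = diag G (j + 1) \<or> e = south G (j + 1) \<and> l = diag G j) \<or>
    j = ntiles G \<and>
      (e = north G j \<and> l = (if odd j then label_w G else label_z G) \<or>
       e = east G j \<and> l = (if odd j then label_z G else label_w G))"
  using assms(1)
proof cases
qed (use assms(2,3) in \<open>simp_all add: sum_height_edges split: if_splits\<close>)

lemma edge_levelD:
  assumes "e \<in> edges G" "sum height e = 2 * j + 1"
  shows "1 \<le> j \<and> j \<le> ntiles G \<and> e \<in> {north G j, east G j} \<or> j < ntiles G \<and> e \<in> {south G (j + 1), west G (j + 1)}"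
proof -
  obtain k where "1 \<le> k" "k \<le> ntiles G" "e \<in> {south G k, west G k, north G k, east G k}"
    using assms by (auto simp: edges_def)
  moreover from this have "k = (if e \<in> {north G k, east G k} then j else j + 1)"
    using assms(2) by (auto simp: sum_height_edges split: if_splits)
  ultimately show ?thesis by (auto split: if_splits)
qed

text \<open>
  The pair \<open>(c, c')\<close> describes how a matching enters the levels \<open>j\<close> and \<open>Suc j\<close>: from below it reaches
  the NW corner iff \<open>c\<close> (iff \<open>c'\<close>), so that it leaves level \<open>j\<close> from the opposite corner.
\<close>

definition link :: "'l snake_graph \<Rightarrow> nat \<Rightarrow> bool \<Rightarrow> bool \<Rightarrow> point set" where
  "link G j c c' = {level_vertex G j (\<not> c), level_vertex G (Suc j) c'}"

text \<open>
  The value 0 on pairs that are not joined by an edge lets the enumerator range over all sets \<open>D\<close>.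
\<close>

definition link_weight :: "'l::linorder snake_graph \<Rightarrow> nat \<Rightarrow> bool \<Rightarrow> bool \<Rightarrow> 'l ratfun" where
  "link_weight G j c c' = (if link G j c c' \<in> edges G then x_var (edge_label G (link G j c c')) else 0)"

lemma link_weight_first:
  assumes "1 \<le> ntiles G"
  shows "link_weight G 0 c c' = x_var (if c' then label_b G else label_a G)"
proof -
  have link: "link G 0 c c' = (if c' then west G 1 else south G 1)"
    using assms level_vertex_inner[of 1 G] by (auto simp: link_def level_vertex_ends west_def south_def)
  have ne: "west G 1 \<noteq> south G 1"
    by (auto simp: west_def south_def NW_def SE_def doubleton_eq_iff)
  have "link G 0 c c' \<in> edges G"
    using assms by (auto simp: link edges_def)
  moreover have "edge_label G (link G 0 c c') = (if c' then label_b G else label_a G)"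
  proof (rule edge_label_eqI)
    show "has_label G (link G 0 c c') (if c' then label_b G else label_a G)"
      by (simp add: link has_label.intros del: One_nat_def)
    show "l = (if c' then label_b G else label_a G)" if "has_label G (link G 0 c c') l" for l
      using has_label_levelD[OF that, of 0] assms ne sum_height_link[of G 0 "\<not> c" c', folded link_def] link
      by (cases c') auto
  qed
  ultimately show ?thesis by (simp add: link_weight_def)
qed

text \<open>A matching entering the last tile at NW leaves it from SE, along the East edge, labelled
  z exactly when the number of tiles is odd; changing either the corner or the parity swaps z and
  w.\<close>

lemma link_weight_last:
  assumes "1 \<le> ntiles G"
  shows "link_weight G (ntiles G) c c' = x_var (if c = odd (ntiles G) then label_z G else label_w G)"
proof -
  have link: "link G (ntiles G) c c' = (if c then east G (ntiles G) else north G (ntiles G))"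
    using assms level_vertex_inner[of "ntiles G" G]
    by (auto simp: link_def level_vertex_ends east_def north_def)
  have ne: "east G (ntiles G) \<noteq> north G (ntiles G)"
    by (auto simp: east_def north_def NW_def SE_def NE_def doubleton_eq_iff)
  have "link G (ntiles G) c c' \<in> edges G"
    using assms by (auto simp: link edges_def)
  moreover have "edge_label G (link G (ntiles G) c c') = (if c = odd (ntiles G) then label_z G else label_w G)"
  proof (rule edge_label_eqI)
    show "has_label G (link G (ntiles G) c c') (if c = odd (ntiles G) then label_z G else label_w G)"
      by (auto simp: link intro: has_label.intros)
    show "l = (if c = odd (ntiles G) then label_z G else label_w G)"
      if "has_label G (link G (ntiles G) c c') l" for l
      using has_label_levelD[OF that, of "ntiles G"] assms ne sum_height_link[of G "ntiles G" "\<not> c" c', folded link_def] link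
      by (cases c) auto
  qed
  ultimately show ?thesis by (simp add: link_weight_def)
qed

text \<open>Between two inner levels the graph is a path of three edges with the glued edge in the
  middle; the value 0 belongs to the pair of its two ends. Reflection in the main diagonal swaps the
  gluings and negates the Booleans, so comparing with \<open>h\<close> treats both at once.\<close>

lemma link_weight_inner:
  assumes "1 \<le> j" "j < ntiles G"
  defines "h \<equiv> (shape G j = North)"
  shows "link_weight G j c c' =
    (if c \<noteq> h \<and> c' \<noteq> h then x_var (glue G j) else if c = h \<and> c' \<noteq> h then x_var (diag G (j + 1))
     else if c \<noteq> h \<and> c' = h then x_var (diag G j) else 0)"
proof -
  obtain p q where pq: "SW G j = (p, q)" by fastforce
  have SW': "SW G (Suc j) = (if h then (p, q + 1) else (p + 1, q))"
    using SW_Suc[of j G] assms pq by (cases "shape G j") (auto simp: h_def)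
  note points = pq SW' NW_def SE_def NE_def east_def north_def south_def west_def
  have link: "link G j x y = {if x then (p + 1, q) else (p, q + 1),
      if h then (if y then (p, q + 2) else (p + 1, q + 1))
      else (if y then (p + 1, q + 1) else (p + 2, q))}" for x y
    using assms by (auto simp: link_def level_vertex_inner level_vertex_def points)
  have sh: "sum height (link G j c c') = 2 * j + 1"
    using assms sum_height_link[of G j] by (simp add: link_def)
  have "link G j c c' \<notin> edges G" if "c = h" "c' = h"
  proof
    assume "link G j c c' \<in> edges G"
    then have "link G j c c' \<in> {north G j, east G j, south G (Suc j), west G (Suc j)}"
      using edge_levelD[OF _ sh] by auto
    then show False
      using that by (cases h) (simp_all add: link points doubleton_eq_iff)
  qed
  moreover have "link G j c c' \<in> edges G \<and>
      edge_label G (link G j c c') = (if c \<noteq> h \<and> c' \<noteq> h then glue G j else if c = h \<and> c' \<noteq> h then diag G (j + 1) else diag G j)"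
    (is "_ \<and> _ = ?l") if ne: "\<not> (c = h \<and> c' = h)"
  proof
    \<comment> \<open>Three edges for each of the two gluings.\<close>
    consider "h" "\<not> c" "\<not> c'" | "h" "c" "\<not> c'" | "h" "\<not> c" "c'"
      | "\<not> h" "c" "c'" | "\<not> h" "\<not> c" "c'" | "\<not> h" "c" "\<not> c'"
      using ne by blast
    then have link': "link G j c c' =
      (if h then (if c \<noteq> h \<and> c' \<noteq> h then north G j else if c = h \<and> c' \<noteq> h then east G j else west G (j + 1))
       else (if c \<noteq> h \<and> c' \<noteq> h then east G j else if c = h \<and> c' \<noteq> h then north G j else south G (j + 1)))"
      by cases (simp_all add: link points)
    show "link G j c c' \<in> edges G"
      using assms by (auto simp: link' edges_def)
    show "edge_label G (link G j c c') = ?l"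
    proof (rule edge_label_eqI)
      have "has_label G (link G j c c') ?l" if h using assms that
        by (simp add: link' has_label.intros del: One_nat_def)
      moreover have "shape G j = East" if "\<not> h" using that by (cases "shape G j") (auto simp: h_def)
      then have "has_label G (link G j c c') ?l" if "\<not> h" using assms that
        by (simp add: link' has_label.intros del: One_nat_def)
      ultimately show "has_label G (link G j c c') ?l" by blast
      show "l = ?l" if "has_label G (link G j c c') l" for l
      proof -
        have "h \<and> (link G j c c' = north G j \<and> l = glue G j \<or> link G j c c' = east G j \<and> l = diag G (j + 1) \<or>
              link G j c c' = west G (j + 1) \<and> l = diag G j) \<or>
            \<not> h \<and> (link G j c c' = east G j \<and> l = glue G j \<or> link G j c c' = north G j \<and> l = diag G (j + 1) \<or>
              link G j c c' = south G (j + 1) \<and> l = diag G j)"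
          using has_label_levelD[OF that sh] assms(1,2) by (cases "shape G j") (simp_all add: h_def)
        then show ?thesis
          using ne
          by (cases c; cases c'; cases h) (simp_all add: link points doubleton_eq_iff)
      qed
    qed
  qed
  ultimately show ?thesis by (auto simp: link_weight_def)
qed

section \<open>Perfect matchings as sets of levels\<close>

definition matching :: "'l snake_graph \<Rightarrow> nat set \<Rightarrow> point set set" where
  "matching G D = (\<lambda>j. link G j (j \<in> D) (Suc j \<in> D)) ` {..ntiles G}"

lemma level_vertex_in_link_iff:
  assumes "1 \<le> ntiles G" "k \<le> Suc (ntiles G)" "j \<le> ntiles G"
  shows "level_vertex G k c \<in> link G j x y \<longleftrightarrow>
    k = j \<and> (1 \<le> j \<longrightarrow> c \<noteq> x) \<or> k = Suc j \<and> (j < ntiles G \<longrightarrow> c = y)"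
  using assms by (auto simp: link_def level_vertex_eq_iff)

lemma link_in_matching:
  "j \<le> ntiles G \<Longrightarrow> link G j (j \<in> D) (Suc j \<in> D) \<in> matching G D"
  by (simp add: matching_def)

text \<open>This concerns levels only and holds for every \<open>D\<close>, whether or not its links
  are edges of the graph.\<close>

lemma matching_unique_edge:
  assumes "1 \<le> ntiles G" "v \<in> vertices G"
  shows "\<exists>!e. e \<in> matching G D \<and> v \<in> e"
proof -
  obtain k c where v: "v = level_vertex G k c" and k: "k \<le> Suc (ntiles G)"
    using assms by (auto simp: vertices_eq)
  \<comment> \<open>The link covering \<open>v\<close> starts at level \<open>k\<close> if
    \<open>v\<close> is the bottom vertex or the corner left upwards, and otherwise one level below;
    \<open>k \<le> ntiles G\<close> sends the top vertex to the last link.\<close>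
  define j where "j = (if k = 0 \<or> k \<le> ntiles G \<and> c = (k \<notin> D) then k else k - 1)"
  have j: "j \<le> ntiles G" using k by (auto simp: j_def)
  have "v \<in> link G i (i \<in> D) (Suc i \<in> D) \<longleftrightarrow> i = j" if "i \<le> ntiles G" for i
    using k that unfolding v level_vertex_in_link_iff[OF assms(1) k that] j_def by auto
  then show ?thesis
    using j by (intro ex1I[of _ "link G j (j \<in> D) (Suc j \<in> D)"]) (auto simp: matching_def)
qed

lemma perfect_matching_matching:
  assumes "1 \<le> ntiles G" "\<And>j. j \<le> ntiles G \<Longrightarrow> link G j (j \<in> D) (Suc j \<in> D) \<in> edges G"
  shows "perfect_matching G (matching G D)"
  using assms matching_unique_edge[OF assms(1)]
  by (auto simp: perfect_matching_def matching_def)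

lemma matching_eqD:
  assumes "1 \<le> ntiles G" "matching G D = matching G D'" "j \<le> ntiles G"
  shows "link G j (j \<in> D) (Suc j \<in> D) = link G j (j \<in> D') (Suc j \<in> D')"
proof -
  obtain i where i: "i \<le> ntiles G" "link G j (j \<in> D) (Suc j \<in> D) = link G i (i \<in> D') (Suc i \<in> D')"
    using link_in_matching[OF assms(3), of D] assms(2) by (auto simp: matching_def)
  then have "2 * j + 1 = 2 * i + 1"
    using assms sum_height_link unfolding link_def by metis
  with i show ?thesis by simp
qed

text \<open>The end levels have one vertex each, so only membership of inner levels can be read off
  from the links; hence the restriction to \<open>{1..ntiles G}\<close>.\<close>

lemma matching_inj:
  assumes "1 \<le> ntiles G"
  shows "inj_on (matching G) (Pow {1..ntiles G})"
proof (intro inj_onI set_eqI)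
  fix D D' k
  assume D: "D \<in> Pow {1..ntiles G}" "D' \<in> Pow {1..ntiles G}" "matching G D = matching G D'"
  show "k \<in> D \<longleftrightarrow> k \<in> D'"
  proof (cases "k \<in> {1..ntiles G}")
    case True
    then obtain j where j: "k = Suc j" "j < ntiles G" by (cases k) auto
    have "level_vertex G k (k \<in> D) \<in> link G j (j \<in> D') (Suc j \<in> D')"
      unfolding matching_eqD[OF assms D(3) less_imp_le[OF j(2)], symmetric]
      by (simp add: link_def j)
    then show ?thesis
      using j assms by (auto simp: level_vertex_in_link_iff)
  qed (use D in auto)
qed

lemma perfect_matching_edge_unique:
  assumes "perfect_matching G P" "v \<in> vertices G" "e \<in> P" "e' \<in> P" "v \<in> e" "v \<in> e'"
  shows "e = e'"
  using assms unfolding perfect_matching_def by blast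

text \<open>
  Level by level: if the links up to level \<open>n\<close> lie in the matching, then one vertex of level
  \<open>Suc n\<close> is matched downwards, and the other one has all its lower neighbours taken.
\<close>

lemma perfect_matching_links:
  assumes "1 \<le> ntiles G" "perfect_matching G P" "n \<le> ntiles G"
  shows "\<exists>D\<subseteq>{1..Suc n}. \<forall>j\<le>n. link G j (j \<in> D) (Suc j \<in> D) \<in> P"
  using assms(3)
proof (induction n)
  case 0
  have "level_vertex G 0 True \<in> vertices G"
    using assms(1) by (auto simp: vertices_eq)
  then obtain e where e: "e \<in> P" "level_vertex G 0 True \<in> e"
    using assms(2) unfolding perfect_matching_def by blast
  then obtain j c c' where j: "j \<le> ntiles G" "e = {level_vertex G j c, level_vertex G (Suc j) c'}"
    using assms(2) edge_between_levels[of e G] unfolding perfect_matching_def by blast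
  with e have "j = 0" using assms(1) by (auto simp: level_vertex_eq_iff)
  with j have "e = link G 0 False c'"
    by (simp add: link_def level_vertex_ends)
  with e show ?case
    by (intro exI[of _ "if c' then {1} else {}"]) auto
next
  case (Suc n)
  then obtain D where D: "D \<subseteq> {1..Suc n}" "\<And>j. j \<le> n \<Longrightarrow> link G j (j \<in> D) (Suc j \<in> D) \<in> P"
    by auto
  \<comment> \<open>The corner of level \<open>Suc n\<close> missed by the links found so
    far.\<close>
  define v where "v = level_vertex G (Suc n) (Suc n \<notin> D)"
  have "v \<in> vertices G"
    using assms(1) Suc.prems by (auto simp: vertices_eq v_def)
  then obtain e where e: "e \<in> P" "v \<in> e"
    using assms(2) unfolding perfect_matching_def by blast
  then obtain j c c' where j: "j \<le> ntiles G" "e = {level_vertex G j c, level_vertex G (Suc j) c'}"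
    using assms(2) edge_between_levels[of e G] unfolding perfect_matching_def by blast
  \<comment> \<open>If \<open>v\<close> were matched downwards to \<open>u\<close>, then
    \<open>e\<close> would be the link that already covers \<open>u\<close>, but that link misses
    \<open>v\<close>.\<close>
  have "v \<noteq> level_vertex G (Suc j) c'"
  proof
    assume v: "v = level_vertex G (Suc j) c'"
    then have [simp]: "j = n"
      using assms(1) Suc.prems j by (auto simp: v_def level_vertex_eq_iff)
    define u where "u = level_vertex G n c"
    have u: "u \<in> vertices G" "u \<in> e"
      using assms(1) Suc.prems j by (auto simp: vertices_eq u_def)
    obtain i where i: "i \<le> n" "u \<in> link G i (i \<in> D) (Suc i \<in> D)"
    proof (cases "n = 0 \<or> c = (n \<notin> D)")
      case True
      then have "u \<in> link G n (n \<in> D) (Suc n \<in> D)"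
        using assms(1) Suc.prems by (auto simp: level_vertex_in_link_iff u_def)
      then show ?thesis using that by blast
    next
      case False
      then have "u \<in> link G (n - 1) (n - 1 \<in> D) (Suc (n - 1) \<in> D)"
        using assms(1) Suc.prems by (auto simp: level_vertex_in_link_iff u_def)
      then show ?thesis using that[of "n - 1"] by auto
    qed
    have "e = link G i (i \<in> D) (Suc i \<in> D)"
      using perfect_matching_edge_unique[OF assms(2) u(1) e(1) D(2)[OF i(1)] u(2) i(2)] .
    then have "v \<in> link G i (i \<in> D) (Suc i \<in> D)" using e by simp
    then show False
      using i assms(1) Suc.prems by (auto simp: level_vertex_in_link_iff v_def)
  qed
  with e j have "v = level_vertex G j c" by auto
  then have "j = Suc n" "c = (Suc n \<notin> D)"
    using assms(1) Suc.prems j by (auto simp: v_def level_vertex_eq_iff)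
  with j have e': "e = link G (Suc n) (Suc n \<in> D) c'" by (simp add: link_def)
  \<comment> \<open>Only the state of level \<open>Suc (Suc n)\<close> is decided here; the bound on
    \<open>D\<close> has left it open.\<close>
  define D' where "D' = (if c' then insert (Suc (Suc n)) D else D)"
  have mem: "i \<in> D' \<longleftrightarrow> i \<in> D" if "i \<le> Suc n" for i
    using that by (auto simp: D'_def)
  have last: "Suc (Suc n) \<in> D' \<longleftrightarrow> c'" using D(1) by (auto simp: D'_def)
  have "D' \<subseteq> {1..Suc (Suc n)}" using D(1) by (auto simp: D'_def)
  moreover have "link G i (i \<in> D') (Suc i \<in> D') \<in> P" if "i \<le> Suc n" for i
  proof (cases "i = Suc n")
    case True
    then show ?thesis using e(1) mem last by (simp add: e')
  qed (use D(2)[of i] mem[of i] mem[of "Suc i"] that in auto)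
  ultimately show ?case by blast
qed

lemma perfect_matching_is_matching:
  assumes "1 \<le> ntiles G" "perfect_matching G P"
  obtains D where "D \<subseteq> {1..ntiles G}" "P = matching G D"
proof -
  obtain D where D: "D \<subseteq> {1..Suc (ntiles G)}"
      "\<And>j. j \<le> ntiles G \<Longrightarrow> link G j (j \<in> D) (Suc j \<in> D) \<in> P"
    using perfect_matching_links[OF assms order_refl] by blast
  \<comment> \<open>Removing the top level changes no link, as that level has a single
    vertex.\<close>
  define D' where "D' = D \<inter> {1..ntiles G}"
  have "link G j (j \<in> D') (Suc j \<in> D') = link G j (j \<in> D) (Suc j \<in> D)" if "j \<le> ntiles G" for j
    using that D(1) by (cases "j = ntiles G") (auto simp: D'_def link_def level_vertex_ends level_vertex_def)
  then have sub: "matching G D' \<subseteq> P" using D by (auto simp: matching_def)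
  \<comment> \<open>The lower end of an edge of \<open>P\<close> is already covered by an edge of
    \<open>matching G D'\<close>, which lies in \<open>P\<close> too; uniqueness identifies the
    two.\<close>
  have "P \<subseteq> matching G D'"
  proof
    fix e assume e: "e \<in> P"
    then obtain j c c' where j: "j \<le> ntiles G" "e = {level_vertex G j c, level_vertex G (Suc j) c'}"
      using assms(2) edge_between_levels[of e G] unfolding perfect_matching_def by blast
    then have v: "level_vertex G j c \<in> vertices G" using assms(1) by (auto simp: vertices_eq)
    then obtain e' where "e' \<in> matching G D'" "level_vertex G j c \<in> e'"
      using matching_unique_edge[OF assms(1)] by blast
    then have "e = e'"
      using perfect_matching_edge_unique[OF assms(2) v e] sub j by blast
    with \<open>e' \<in> _\<close> show "e \<in> matching G D'" by simp
  qed
  with sub that[of D'] show thesis by (auto simp: D'_def)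
qed

section \<open>The alternating path and the orientation of the diagonals\<close>

definition zigzag_vertex :: "'l snake_graph \<Rightarrow> nat set \<Rightarrow> nat \<Rightarrow> point" where
  "zigzag_vertex G D k = level_vertex G ((k + 1) div 2) (odd k = ((k + 1) div 2 \<in> D))"

text \<open>Position \<open>2 * j - 1\<close> is where the path enters level \<open>j\<close>,
  position \<open>2 * j\<close> where it leaves; the two single end vertices bring the length to
  \<open>2 * ntiles G + 2\<close>.\<close>

definition zigzag :: "'l snake_graph \<Rightarrow> nat set \<Rightarrow> point list" where
  "zigzag G D = map (zigzag_vertex G D) [0..<2 * ntiles G + 2]"

lemma zigzag_nth:
  "length (zigzag G D) = 2 * ntiles G + 2"
  "k < 2 * ntiles G + 2 \<Longrightarrow> zigzag G D ! k = zigzag_vertex G D k"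
  by (simp_all add: zigzag_def del: upt_Suc)

lemma zigzag_vertex_simps:
  "zigzag_vertex G D (2 * j) = level_vertex G j (j \<notin> D)"
  "zigzag_vertex G D (Suc (2 * j)) = level_vertex G (Suc j) (Suc j \<in> D)"
  by (auto simp: zigzag_vertex_def)

text \<open>Height gives the level \<open>(k + 1) div 2\<close>, and on inner levels the corner
  gives the parity of \<open>k\<close>; each end level occurs at one position only.\<close>

lemma zigzag_vertex_inj:
  assumes "1 \<le> ntiles G"
  shows "inj_on (zigzag_vertex G D) {..<2 * ntiles G + 2}"
proof (rule inj_onI)
  fix k l assume kl: "k \<in> {..<2 * ntiles G + 2}" "l \<in> {..<2 * ntiles G + 2}"
    "zigzag_vertex G D k = zigzag_vertex G D l"
  then have "(k + 1) div 2 \<le> Suc (ntiles G)" "(l + 1) div 2 \<le> Suc (ntiles G)"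
    by auto
  with kl assms have "(k + 1) div 2 = (l + 1) div 2"
    "1 \<le> (k + 1) div 2 \<and> (k + 1) div 2 \<le> ntiles G \<longrightarrow> odd k = odd l"
    by (auto simp: zigzag_vertex_def level_vertex_eq_iff)
  with kl show "k = l" unfolding lessThan_iff by presburger
qed

lemma diagonal_eq:
  "1 \<le> j \<Longrightarrow> j \<le> ntiles G \<Longrightarrow> diagonal G j = {level_vertex G j c, level_vertex G j (\<not> c)}"
  by (cases c) (auto simp: diagonal_def level_vertex_inner)

lemma link_zigzag:
  "link G j (j \<in> D) (Suc j \<in> D) = {zigzag_vertex G D (2 * j), zigzag_vertex G D (Suc (2 * j))}"
  by (simp add: link_def zigzag_vertex_simps)

lemma diagonal_zigzag:
  assumes "1 \<le> j" "j \<le> ntiles G"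
  shows "diagonal G j = {zigzag_vertex G D (2 * j - 1), zigzag_vertex G D (2 * j)}"
proof -
  have "2 * j - 1 = Suc (2 * (j - 1))" "Suc (j - 1) = j" using assms by auto
  then show ?thesis
    using assms diagonal_eq[of j G "j \<in> D"] by (simp only: zigzag_vertex_simps)
qed

lemma alternating_path_zigzag:
  assumes "1 \<le> ntiles G"
  shows "alternating_path G (matching G D) (zigzag G D)"
  unfolding alternating_path_def
proof (intro conjI allI impI)
  have len: "length (zigzag G D) = 2 * ntiles G + 2" by (rule zigzag_nth)
  then show ne: "zigzag G D \<noteq> []" by auto
  show "distinct (zigzag G D)"
    using zigzag_vertex_inj[OF assms, of D]
    by (simp add: zigzag_def distinct_map atLeast0LessThan del: upt_Suc)
  show "hd (zigzag G D) = SW G 1"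
    using zigzag_vertex_simps(1)[of G D 0] by (simp add: hd_conv_nth[OF ne] zigzag_nth level_vertex_ends)
  show "last (zigzag G D) = NE G (ntiles G)"
    using zigzag_vertex_simps(2)[of G D "ntiles G"]
    by (simp add: last_conv_nth[OF ne] zigzag_nth level_vertex_ends)
  fix k assume k: "Suc k < length (zigzag G D)"
  show "{zigzag G D ! k, zigzag G D ! Suc k} \<in> (if even k then matching G D else diagonals G)"
  proof (cases "even k")
    case True
    then obtain j where "k = 2 * j" by blast
    then show ?thesis
      using k link_in_matching[of j G D] by (simp add: zigzag_nth link_zigzag)
  next
    case False
    then obtain i where "k = 2 * i + 1" by (elim oddE)
    then have "k = 2 * Suc i - 1" "Suc k = 2 * Suc i" "1 \<le> Suc i" "Suc i \<le> ntiles G"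
      using k by (auto simp: zigzag_nth)
    moreover from this have "diagonal G (Suc i) \<in> diagonals G" unfolding diagonals_def by auto
    ultimately show ?thesis
      using k diagonal_zigzag[of "Suc i" G D] False by (auto simp: zigzag_nth)
  qed
qed

text \<open>The steps allowed at position \<open>k\<close> are links or diagonals, all of them steps
  of the zigzag of the same parity; thus any alternating path is an initial segment of it.\<close>

lemma alternating_path_nth:
  assumes "1 \<le> ntiles G" "alternating_path G (matching G D) vs" "k < length vs"
  shows "k < 2 * ntiles G + 2 \<and> vs ! k = zigzag_vertex G D k"
  using assms(3)
proof (induction k)
  case 0
  then show ?case
    using assms(2) zigzag_vertex_simps(1)[of G D 0]
    by (auto simp: alternating_path_def hd_conv_nth level_vertex_ends)
next
  case (Suc k)
  then have IH: "k < 2 * ntiles G + 2" "vs ! k = zigzag_vertex G D k" by auto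
  have step: "{vs ! k, vs ! Suc k} \<in> (if even k then matching G D else diagonals G)"
    using assms(2) Suc.prems by (auto simp: alternating_path_def)
  obtain l where l: "l < 2 * ntiles G + 2" "Suc l < 2 * ntiles G + 2" "even l = even k"
    "{vs ! k, vs ! Suc k} = {zigzag_vertex G D l, zigzag_vertex G D (Suc l)}"
  proof (cases "even k")
    case True
    with step obtain j where "j \<le> ntiles G" "{vs ! k, vs ! Suc k} = link G j (j \<in> D) (Suc j \<in> D)"
      by (auto simp: matching_def)
    with True that[of "2 * j"] show ?thesis by (auto simp: link_zigzag)
  next
    case False
    with step obtain j where j: "1 \<le> j" "j \<le> ntiles G" "{vs ! k, vs ! Suc k} = diagonal G j"
      by (auto simp: diagonals_def)
    moreover have "Suc (2 * j - 1) = 2 * j" "odd (2 * j - 1)" using j by auto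
    ultimately show ?thesis
      using False that[of "2 * j - 1"] diagonal_zigzag[of j G D] by auto
  qed
  \<comment> \<open>The case \<open>k = Suc l\<close> means turning back; parity excludes
    it.\<close>
  have "k = l \<or> k = Suc l"
    using l(4) IH inj_onD[OF zigzag_vertex_inj[OF assms(1)], of D k l]
      inj_onD[OF zigzag_vertex_inj[OF assms(1)], of D k "Suc l"] l(1,2)
    by (auto simp: doubleton_eq_iff)
  with l(3) have "k = l" by auto
  with l IH show ?case by (auto simp: doubleton_eq_iff)
qed

text \<open>Ending at the NE corner of the last tile forces an initial segment of the zigzag to be
  all of it.\<close>

lemma matching_path_matching:
  assumes "1 \<le> ntiles G"
  shows "matching_path G (matching G D) = zigzag G D"
  unfolding matching_path_def
proof (rule the_equality)
  show "alternating_path G (matching G D) (zigzag G D)"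
    by (rule alternating_path_zigzag[OF assms])
  fix vs assume vs: "alternating_path G (matching G D) vs"
  note nth = alternating_path_nth[OF assms vs]
  have ne: "vs \<noteq> []" using vs by (simp add: alternating_path_def)
  define k where "k = length vs - 1"
  have k: "k < length vs" using ne by (simp add: k_def)
  have "vs ! k = NE G (ntiles G)"
    using vs by (simp add: alternating_path_def last_conv_nth[OF ne] k_def)
  then have "zigzag_vertex G D k = zigzag_vertex G D (2 * ntiles G + 1)"
    using nth[OF k] zigzag_vertex_simps(2)[of G D "ntiles G"] by (simp add: level_vertex_ends)
  then have "k = 2 * ntiles G + 1"
    using inj_onD[OF zigzag_vertex_inj[OF assms]] nth[OF k] by fastforce
  then have "length vs = 2 * ntiles G + 2" using k_def ne by (cases vs) auto
  then show "vs = zigzag G D"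
    using nth by (intro nth_equalityI) (auto simp: zigzag_nth)
qed

lemma traverses_zigzag_diagonal:
  assumes "1 \<le> ntiles G" "1 \<le> j" "j \<le> ntiles G"
  shows "traverses (zigzag G D) (level_vertex G j c) (level_vertex G j (\<not> c)) \<longleftrightarrow> c = (j \<in> D)"
proof
  define i where "i = j - 1"
  then have i: "j = Suc i" using assms by simp
  assume "c = (j \<in> D)"
  then show "traverses (zigzag G D) (level_vertex G j c) (level_vertex G j (\<not> c))"
    using assms zigzag_vertex_simps(1)[of G D j] zigzag_vertex_simps(2)[of G D i] unfolding traverses_def
    by (intro exI[of _ "Suc (2 * i)"]) (simp add: zigzag_nth i)
next
  assume "traverses (zigzag G D) (level_vertex G j c) (level_vertex G j (\<not> c))"
  then obtain k where k: "Suc k < 2 * ntiles G + 2" "zigzag_vertex G D k = level_vertex G j c"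
    "zigzag_vertex G D (Suc k) = level_vertex G j (\<not> c)"
    by (auto simp: traverses_def zigzag_nth)
  then have "(k + 1) div 2 \<le> Suc (ntiles G)" "(Suc k + 1) div 2 \<le> Suc (ntiles G)" by auto
  with k assms have "(k + 1) div 2 = j" "(Suc k + 1) div 2 = j" "c = (odd k = (j \<in> D))"
    unfolding zigzag_vertex_def by (auto simp: level_vertex_eq_iff)
  \<comment> \<open>Two consecutive positions lie on one level only if the first is odd, that is,
    where the level is entered.\<close>
  moreover from this(1,2) have "odd k" by presburger
  ultimately show "c = (j \<in> D)" by simp
qed

lemma oriented_matching:
  assumes "1 \<le> ntiles G" "1 \<le> j" "j \<le> ntiles G"
  shows "oriented_down G (matching G D) j \<longleftrightarrow> j \<in> D" "oriented_up G (matching G D) j \<longleftrightarrow> j \<notin> D"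
  using traverses_zigzag_diagonal[OF assms, of D True] traverses_zigzag_diagonal[OF assms, of D False]
  by (simp_all add: oriented_down_def oriented_up_def matching_path_matching[OF assms(1)] level_vertex_inner[OF assms(2,3)])

section \<open>The enumerator as a transfer matrix product\<close>

text \<open>A row vector times a product of 2 by 2 matrices, indexed by the state of the next level;
  level 0 has state \<open>False\<close> because the sets \<open>D\<close> start at 1.\<close>

primrec transfer :: "(nat \<Rightarrow> bool \<Rightarrow> bool \<Rightarrow> 'a::comm_semiring_1) \<Rightarrow> nat \<Rightarrow> bool \<Rightarrow> 'a" where
  "transfer W 0 c' = W 0 False c'"
| "transfer W (Suc n) c' = transfer W n False * W (Suc n) False c' + transfer W n True * W (Suc n) True c'"

text \<open>Split the subsets by membership of the top level; \<open>c'\<close> stays arbitrary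
  because both of its values occur in the induction.\<close>

lemma sum_Pow_transfer:
  "(\<Sum>D\<in>Pow {1..n}. (\<Prod>j<n. W j (j \<in> D) (Suc j \<in> D)) * W n (n \<in> D) c') = transfer W n c'"
proof (induction n arbitrary: c')
  case (Suc n)
  define f where "f D = (\<Prod>j<n. W j (j \<in> D) (Suc j \<in> D))" for D
  have inj: "inj_on (insert (Suc n)) (Pow {1..n})"
    by (rule inj_on_inverseI[where g = "\<lambda>D. D - {Suc n}"]) auto
  have 1: "f (insert (Suc n) D) = f D" for D
    unfolding f_def by (intro prod.cong) auto
  have "(\<Sum>D\<in>Pow {1..Suc n}. (\<Prod>j<Suc n. W j (j \<in> D) (Suc j \<in> D)) * W (Suc n) (Suc n \<in> D) c') =
      (\<Sum>D\<in>Pow {1..n} \<union> insert (Suc n) ` Pow {1..n}. f D * W n (n \<in> D) (Suc n \<in> D) * W (Suc n) (Suc n \<in> D) c')"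
    by (simp add: f_def atLeastAtMostSuc_conv Pow_insert)
  also have "\<dots> = (\<Sum>D\<in>Pow {1..n}. f D * W n (n \<in> D) (Suc n \<in> D) * W (Suc n) (Suc n \<in> D) c') +
      (\<Sum>D\<in>Pow {1..n}. f D * W n (n \<in> D) True * W (Suc n) True c')"
    by (subst sum.union_disjoint) (auto simp: sum.reindex[OF inj] 1 simp del: One_nat_def)
  also have "(\<Sum>D\<in>Pow {1..n}. f D * W n (n \<in> D) (Suc n \<in> D) * W (Suc n) (Suc n \<in> D) c') =
      (\<Sum>D\<in>Pow {1..n}. f D * W n (n \<in> D) False * W (Suc n) False c')"
  proof (intro sum.cong refl)
    fix D assume "D \<in> Pow {1..n}"
    then have "Suc n \<notin> D" by auto
    then show "f D * W n (n \<in> D) (Suc n \<in> D) * W (Suc n) (Suc n \<in> D) c' =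
        f D * W n (n \<in> D) False * W (Suc n) False c'" by simp
  qed
  also have "(\<Sum>D\<in>Pow {1..n}. f D * W n (n \<in> D) False * W (Suc n) False c') = transfer W n False * W (Suc n) False c'"
    unfolding f_def sum_distrib_right[symmetric] Suc.IH ..
  also have "(\<Sum>D\<in>Pow {1..n}. f D * W n (n \<in> D) True * W (Suc n) True c') = transfer W n True * W (Suc n) True c'"
    unfolding f_def sum_distrib_right[symmetric] Suc.IH ..
  finally show ?case by simp
qed simp

text \<open>The condition \<open>1 \<le> j\<close> is there because level 0 carries no diagonal.\<close>

definition y_factor :: "'l::linorder snake_graph \<Rightarrow> ('l \<Rightarrow> int) \<Rightarrow> nat \<Rightarrow> bool \<Rightarrow> 'l ratfun" where
  "y_factor G b j c =
     (if 1 \<le> j \<and> (c = odd j) = (b (diag G j) = 1) then y_var (diag G j) else 1)"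

lemma x_weight_matching:
  assumes "1 \<le> ntiles G"
  shows "x_weight G (matching G D) = (\<Prod>j\<le>ntiles G. x_var (edge_label G (link G j (j \<in> D) (Suc j \<in> D))))"
proof -
  have "inj_on (\<lambda>j. link G j (j \<in> D) (Suc j \<in> D)) {..ntiles G}"
  proof (rule inj_onI)
    fix i j assume ij: "i \<in> {..ntiles G}" "j \<in> {..ntiles G}"
      "link G i (i \<in> D) (Suc i \<in> D) = link G j (j \<in> D) (Suc j \<in> D)"
    then have "2 * i + 1 = 2 * j + 1"
      using assms sum_height_link unfolding link_def atMost_iff by metis
    then show "i = j" by simp
  qed
  then show ?thesis by (simp add: x_weight_def matching_def prod.reindex)
qed

text \<open>Down means \<open>j \<in> D\<close> and up its negation, so the four cases of
  \<open>lam_oriented\<close> collapse to one equivalence for signs 1 and -1.\<close>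

lemma y_weight_matching:
  assumes "1 \<le> ntiles G" "\<forall>j\<in>{1..ntiles G}. b (diag G j) \<in> {1, - 1}"
  shows "y_weight G b (matching G D) = (\<Prod>j\<le>ntiles G. y_factor G b j (j \<in> D))"
proof -
  have "lam_oriented G b (matching G D) j \<longleftrightarrow> ((j \<in> D) = odd j) = (b (diag G j) = 1)"
    if "j \<in> {1..ntiles G}" for j
    using assms(2) that by (auto simp: lam_oriented_def oriented_matching[OF assms(1)])
  then have "y_weight G b (matching G D) = (\<Prod>j\<in>{j\<in>{1..ntiles G}. ((j \<in> D) = odd j) = (b (diag G j) = 1)}. y_var (diag G j))"
    unfolding y_weight_def by (intro prod.cong) auto
  also have "\<dots> = (\<Prod>j\<in>{1..ntiles G}. y_factor G b j (j \<in> D))"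
    by (subst prod.inter_filter) (auto simp: y_factor_def intro!: prod.cong)
  also have "\<dots> = (\<Prod>j\<le>ntiles G. y_factor G b j (j \<in> D))"
    by (intro prod.mono_neutral_left) (auto simp: y_factor_def)
  finally show ?thesis .
qed

definition local_weight :: "'l::linorder snake_graph \<Rightarrow> ('l \<Rightarrow> int) \<Rightarrow> nat \<Rightarrow> bool \<Rightarrow> bool \<Rightarrow> 'l ratfun" where
  "local_weight G b j c c' = link_weight G j c c' * y_factor G b j c"

lemma matching_enumerator:
  assumes "1 \<le> ntiles G" "\<forall>j\<in>{1..ntiles G}. b (diag G j) \<in> {1, - 1}"
  shows "(\<Sum>P | perfect_matching G P. x_weight G P * y_weight G b P) = transfer (local_weight G b) (ntiles G) False"
proof -
  define adm where "adm D \<longleftrightarrow> (\<forall>j\<le>ntiles G. link G j (j \<in> D) (Suc j \<in> D) \<in> edges G)" for D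
  define w where "w D = (\<Prod>j\<le>ntiles G. local_weight G b j (j \<in> D) (Suc j \<in> D))" for D
  have "{P. perfect_matching G P} = matching G ` {D \<in> Pow {1..ntiles G}. adm D}"
  proof (intro set_eqI iffI)
    fix P assume "P \<in> {P. perfect_matching G P}"
    then have P: "perfect_matching G P" by simp
    then obtain D where "D \<subseteq> {1..ntiles G}" "P = matching G D"
      using perfect_matching_is_matching[OF assms(1)] by blast
    moreover from this P have "adm D"
      using link_in_matching[of _ G D] by (auto simp: adm_def perfect_matching_def)
    ultimately show "P \<in> matching G ` {D \<in> Pow {1..ntiles G}. adm D}" by blast
  qed (use perfect_matching_matching[OF assms(1)] in \<open>auto simp: adm_def\<close>)
  moreover have "inj_on (matching G) {D \<in> Pow {1..ntiles G}. adm D}"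
    using matching_inj[OF assms(1)] by (rule inj_on_subset) auto
  ultimately have "(\<Sum>P | perfect_matching G P. x_weight G P * y_weight G b P) =
      (\<Sum>D | D \<in> Pow {1..ntiles G} \<and> adm D. x_weight G (matching G D) * y_weight G b (matching G D))"
    by (simp add: sum.reindex)
  also have "\<dots> = (\<Sum>D | D \<in> Pow {1..ntiles G} \<and> adm D. w D)"
    by (intro sum.cong)
      (auto simp: w_def adm_def x_weight_matching[OF assms(1)] y_weight_matching[OF assms] local_weight_def link_weight_def prod.distrib)
  \<comment> \<open>A set with a link that is not an edge has a zero factor.\<close>
  also have "\<dots> = (\<Sum>D\<in>Pow {1..ntiles G}. w D)"
  proof (intro sum.mono_neutral_left ballI)
    fix D assume "D \<in> Pow {1..ntiles G} - {D. D \<in> Pow {1..ntiles G} \<and> adm D}"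
    then obtain j where "j \<le> ntiles G" "link G j (j \<in> D) (Suc j \<in> D) \<notin> edges G"
      by (auto simp: adm_def)
    then show "w D = 0"
      unfolding w_def by (intro prod_zero) (auto simp: local_weight_def link_weight_def)
  qed auto
  \<comment> \<open>The top level is not in \<open>D\<close>, hence the final state
    \<open>False\<close>.\<close>
  also have "\<dots> = (\<Sum>D\<in>Pow {1..ntiles G}. (\<Prod>j<ntiles G. local_weight G b j (j \<in> D) (Suc j \<in> D)) *
      local_weight G b (ntiles G) (ntiles G \<in> D) False)"
  proof (intro sum.cong refl)
    fix D assume "D \<in> Pow {1..ntiles G}"
    then have "Suc (ntiles G) \<notin> D" by auto
    then show "w D = (\<Prod>j<ntiles G. local_weight G b j (j \<in> D) (Suc j \<in> D)) *
        local_weight G b (ntiles G) (ntiles G \<in> D) False"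
      by (simp add: w_def lessThan_Suc_atMost[symmetric])
  qed
  finally show ?thesis by (simp only: sum_Pow_transfer)
qed

section \<open>Transfer matrices and the matrices $m_j$\<close>

lemma x_var_nonzero [simp]: "x_var l \<noteq> 0"
proof -
  have "Poly_Mapping.single m (1::int) \<noteq> 0" for m :: "'a indet \<Rightarrow>\<^sub>0 nat"
    by (metis lookup_single_eq lookup_zero zero_neq_one)
  then show ?thesis
    by (simp add: x_var_def indet_def Zero_fract_def eq_fract)
qed

lemma mat2_nth [simp]:
  "mat2 p q r s $ 1 $ 1 = p" "mat2 p q r s $ 1 $ 2 = q"
  "mat2 p q r s $ 2 $ 1 = r" "mat2 p q r s $ 2 $ 2 = s"
  by (simp_all add: mat2_def)

lemma matrix_mul_nth_2:
  fixes A :: "'a::comm_semiring_1 ^ 2 ^ 2"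
  shows "(A ** B) $ i $ k = A $ i $ 1 * B $ 1 $ k + A $ i $ 2 * B $ 2 $ k"
  by (simp add: matrix_matrix_mult_def sum_2)

text \<open>Exactly one of shape and type changes at each step, so their agreement alternates with
  \<open>j\<close>.\<close>

lemma first_type_iff: "1 \<le> j \<Longrightarrow> first_type G j \<longleftrightarrow> (shape G j = North) = odd j"
proof (induction G j rule: first_type.induct)
  case (3 G j)
  then show ?case by (cases "shape G (Suc j)"; cases "shape G (Suc (Suc j))") auto
qed auto

text \<open>
  The first component belongs to the state at level \<open>Suc n\<close> in which $y$ does not occur for sign 1: up
  for odd levels, down for even ones.
\<close>

lemma transfer_eq_matrix_column:
  fixes G :: "'l::linorder snake_graph"
  assumes "n < ntiles G" "\<forall>j\<in>{1..ntiles G}. b (diag G j) \<in> {1, - 1}"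
  defines "R \<equiv> mat2 0 (x_var (label_a G)) (- 1 / x_var (label_a G)) (x_var (label_b G) / x_var (diag G 1))"
  shows "transfer (local_weight G b) n (odd n) = (\<Prod>j=1..n. x_var (diag G j)) * (step_product G b n ** R) $ 1 $ 2
    \<and> transfer (local_weight G b) n (even n) = (\<Prod>j=1..Suc n. x_var (diag G j)) * (step_product G b n ** R) $ 2 $ 2"
  using assms(1)
proof (induction n)
  case 0
  \<comment> \<open>At level 0 the pair is \<open>x_a\<close>, \<open>x_b\<close>: the second column
    of \<open>R\<close> with its lower entry scaled by the first diagonal variable.\<close>
  then show ?case
    by (simp add: local_weight_def link_weight_first y_factor_def R_def del: One_nat_def) simp
next
  case (Suc n)
  define V where "V = step_product G b n ** R"
  define p where "p = (\<Prod>j=1..n. x_var (diag G j))"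
  define j where "j = Suc n"
  define xj where "xj = x_var (diag G j)"
  define xj' where "xj' = x_var (diag G (Suc j))"
  define xa where "xa = x_var (glue G j)"
  define yj where "yj = y_var (diag G j)"
  have b: "b (diag G j) = 1 \<or> b (diag G j) = -1" using assms(2) Suc.prems by (auto simp: j_def)
  have IH: "transfer (local_weight G b) n (odd n) = p * V $ 1 $ 2"
    "transfer (local_weight G b) n (even n) = p * xj * V $ 2 $ 2"
    using Suc by (simp_all add: V_def p_def xj_def j_def)
  have V': "step_product G b (Suc n) ** R = step_matrix G b j ** V"
    by (simp add: V_def matrix_mul_assoc j_def)
  have nz: "xj \<noteq> 0" "xj' \<noteq> 0" by (simp_all add: xj_def xj'_def)
  have prods: "(\<Prod>j=1..Suc n. x_var (diag G j)) = p * xj"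
    "(\<Prod>j=1..Suc (Suc n). x_var (diag G j)) = p * xj * xj'"
    by (simp_all add: p_def xj_def xj'_def j_def)
  have ft: "first_type G j \<longleftrightarrow> (shape G j = North) = odd j"
    by (rule first_type_iff) (simp add: j_def)
  have W: "local_weight G b j c c' = link_weight G j c c' * (if (c = odd j) = (b (diag G j) = 1) then yj else 1)" for c c'
    by (simp add: local_weight_def y_factor_def yj_def j_def)
  have L: "link_weight G j c c' = (let h = (shape G j = North) in
    if c \<noteq> h \<and> c' \<noteq> h then xa else if c = h \<and> c' \<noteq> h then xj' else if c \<noteq> h \<and> c' = h then xj else 0)" for c c'
    using link_weight_inner[of j G c c'] Suc.prems by (simp add: j_def xa_def xj_def xj'_def Let_def)
  have S: "step_matrix G b j =
    (if b (diag G j) = 1 then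
       (if first_type G j then mat2 1 0 (xa / (xj * xj')) yj else mat2 (xj' / xj) (xa * yj) 0 (xj * yj / xj'))
     else
       (if first_type G j then mat2 yj 0 (xa * yj / (xj * xj')) 1 else mat2 (xj' * yj / xj) xa 0 (xj / xj')))"
    by (simp add: step_matrix_def xa_def xj_def xj'_def yj_def Let_def)
  have T: "transfer (local_weight G b) (Suc n) c' =
    transfer (local_weight G b) n False * local_weight G b j False c' +
    transfer (local_weight G b) n True * local_weight G b j True c'" for c'
    by (simp add: j_def)
  \<comment> \<open>The states exchange their roles from one level to the next.\<close>
  have par: "odd j \<longleftrightarrow> even n" by (simp add: j_def)
  show ?case
    unfolding V' prods matrix_mul_nth_2 T W L S ft Let_def
    using IH b nz unfolding par
    \<comment> \<open>Parity and shape determine the type of the matrix, whose zero entry is the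
      missing link; each case is an identity of rational functions.\<close>
    by (cases "even n"; cases "shape G j"; auto simp: par j_def[symmetric] field_simps)
qed

text \<open>State \<open>odd d\<close> closes with z and state \<open>even d\<close> with w; for
  \<open>n = d - 1\<close> these are the second and first components of the matrix column.\<close>

lemma transfer_last:
  assumes "1 \<le> d" "ntiles G = d"
  shows "transfer (local_weight G b) d False =
    transfer (local_weight G b) (d - 1) (even d) * x_var (label_w G) * y_factor G b d (even d) +
    transfer (local_weight G b) (d - 1) (odd d) * x_var (label_z G) * y_factor G b d (odd d)"
proof -
  obtain n where n: "d = Suc n" using assms(1) by (cases d) auto
  show ?thesis
    using assms by (cases "even n") (simp_all add: n local_weight_def link_weight_last[of G, unfolded assms(2) n] ac_simps)
qed

theorem theorem5p14:
  fixes G :: "'l::linorder snake_graph" and b :: "'l \<Rightarrow> int" and d :: nat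
  assumes "ntiles G = d" and "1 \<le> d"
    and "\<forall>j\<in>{1..d}. b (diag G j) \<in> {1, - 1}"
  shows "(b (diag G d) = 1 \<longrightarrow>
      (\<Sum>P | perfect_matching G P. x_weight G P * y_weight G b P) =
        (\<Prod>j=1..d. x_var (diag G j)) *
        ur (mat2 (x_var (label_w G) / x_var (diag G d)) (x_var (label_z G) * y_var (diag G d))
                 (- 1 / x_var (label_z G))          0
            ** snake_matrix G b
            ** mat2 0                       (x_var (label_a G))
                    (- 1 / x_var (label_a G))   (x_var (label_b G) / x_var (diag G 1))))
    \<and> (b (diag G d) = - 1 \<longrightarrow>
      (\<Sum>P | perfect_matching G P. x_weight G P * y_weight G b P) =
        (\<Prod>j=1..d. x_var (diag G j)) *
        ur (mat2 (x_var (label_w G) * y_var (diag G d) / x_var (diag G d)) (x_var (label_z G))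
                 (- y_var (diag G d) / x_var (label_z G))              0
            ** snake_matrix G b
            ** mat2 0                       (x_var (label_a G))
                    (- 1 / x_var (label_a G))   (x_var (label_b G) / x_var (diag G 1))))"
proof -
  obtain n where n: "d = Suc n" using assms(2) by (cases d) auto
  define R where "R = mat2 0 (x_var (label_a G)) (- 1 / x_var (label_a G)) (x_var (label_b G) / x_var (diag G 1))"
  define V where "V = snake_matrix G b ** R"
  define p where "p = (\<Prod>j=1..n. x_var (diag G j))"
  have col: "transfer (local_weight G b) n (even d) = p * V $ 1 $ 2"
    "transfer (local_weight G b) n (odd d) = p * x_var (diag G d) * V $ 2 $ 2"
    using transfer_eq_matrix_column[of n G b] assms
    by (simp_all add: V_def R_def p_def n snake_matrix_def)
  have p: "(\<Prod>j=1..d. x_var (diag G j)) = p * x_var (diag G d)"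
    by (simp add: n p_def)
  have "(\<Sum>P | perfect_matching G P. x_weight G P * y_weight G b P) =
      p * V $ 1 $ 2 * x_var (label_w G) * y_factor G b d (even d) +
      p * x_var (diag G d) * V $ 2 $ 2 * x_var (label_z G) * y_factor G b d (odd d)"
    using matching_enumerator[of G b] transfer_last[of d G b] assms col by (simp add: n)
  \<comment> \<open>For sign 1 the y-variable accompanies the state \<open>odd d\<close>, hence z;
    for sign -1 it accompanies w. The last diagonal variable cancels the denominator in the w
    entry.\<close>
  then show ?thesis
    unfolding R_def[symmetric] matrix_mul_assoc[symmetric] V_def[symmetric] ur_def matrix_mul_nth_2 p
    using assms(2) by (auto simp: y_factor_def field_simps)
qed

end
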